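(* Let $n \geq 1$ and let $\mathbb{F}_q$ be a finite field with $q$ elements. If $q$ is odd, or $q = 2^m$ with $m \geq 2$, then $\pi_q(\mathrm{EA}_n(\mathbb{F}_q)) \subset \mathrm{Alt}(\mathbb{F}_q^n)$.
   Context: $\mathrm{EA}_n(\mathbb{F}_q)$ is the set of elementary automorphisms over $\mathbb{F}_q$, i.e. polynomial maps of the form $(X_1,\ldots,X_{i-1},X_i + a_i,X_{i+1},\ldots,X_n)$ with $1 \leq i \leq n$ and $a_i \in \mathbb{F}_q[X_1,\ldots,X_{i-1},X_{i+1},\ldots,X_n]$. For a polynomial automorphism $F=(f_1,\ldots,f_n)$ over $\mathbb{F}_q$ (an $n$-tuple of polynomials in $\mathbb{F}_q[X_1,\ldots,X_n]$ invertible under composition), $\pi_q(F)$ is the permutation $x \mapsto (f_1(x),\ldots,f_n(x))$ of $\mathbb{F}_q^n$ it induces. $\mathrm{Alt}(S)$ is the alternating group on a finite set $S$. *)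

theory Defs
  imports
    "HOL-Library.Poly_Mapping"
    "HOL-Combinatorics.Permutations"
    "HOL-Analysis.Finite_Cartesian_Product"
begin

(* Polynomials over 'a in variables indexed by the finite type 'n, as finitely supported
   coefficient functions on exponent vectors; the ring structure is that of Poly_Mapping. *)
type_synonym ('a, 'n) mpoly = "('n \<Rightarrow>\<^sub>0 nat) \<Rightarrow>\<^sub>0 'a"

definition Var :: "'n \<Rightarrow> ('a::comm_ring_1, 'n) mpoly" where
  "Var i = Poly_Mapping.single (Poly_Mapping.single i 1) 1"

definition vars :: "('a::comm_ring_1, 'n) mpoly \<Rightarrow> 'n set" where
  "vars p = (\<Union>m\<in>Poly_Mapping.keys p. Poly_Mapping.keys m)"

definition poly_eval :: "('a::comm_ring_1, 'n::finite) mpoly \<Rightarrow> 'a ^ 'n \<Rightarrow> 'a" where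
  "poly_eval p x =
     (\<Sum>m\<in>Poly_Mapping.keys p.
        Poly_Mapping.lookup p m * (\<Prod>j\<in>UNIV. (x $ j) ^ Poly_Mapping.lookup m j))"

definition elementary ::
    "'n::finite \<Rightarrow> ('a::comm_ring_1, 'n) mpoly \<Rightarrow> ('a, 'n) mpoly ^ 'n" where
  "elementary i a = (\<chi> j. if j = i then Var i + a else Var j)"

(* a ranges over the polynomials in the variables other than the i-th. *)
definition EA :: "(('a::comm_ring_1, 'n::finite) mpoly ^ 'n) set" where
  "EA = {elementary i a | i a. i \<notin> vars a}"

(* Defined on all polynomial maps, so that it need not be a permutation in general;
   it is one whenever F is a polynomial automorphism. *)
definition induced_map ::
    "('a::comm_ring_1, 'n::finite) mpoly ^ 'n \<Rightarrow> 'a ^ 'n \<Rightarrow> 'a ^ 'n" where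
  "induced_map F x = (\<chi> j. poly_eval (F $ j) x)"

definition Alt :: "'b set \<Rightarrow> ('b \<Rightarrow> 'b) set" where
  "Alt S = {p. p permutes S \<and> evenperm p}"

end

theory Submission
  imports Defs
begin

text \<open>
  An elementary automorphism adds to the \<open>i\<close>-th coordinate a function \<open>f\<close> not depending on that
  coordinate. Such shears are normalised by the scaling of the \<open>i\<close>-th coordinate by a factor \<open>c\<close>, so
  for \<open>c \<noteq> 0, 1\<close> the shear by \<open>f\<close> is the commutator of this scaling with the shear by
  \<open>f / (c - 1)\<close>, hence even. Such \<open>c\<close> exists because the hypothesis excludes only the field
  with two elements.
\<close>

text \<open>Coefficients may cancel in \<open>p + q\<close>, so the sums can run over different
  monomials; a monomial outside a support contributes zero, so all of them extend to a common index
  set.\<close>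

lemma poly_eval_plus: "poly_eval (p + q) x = poly_eval p x + poly_eval q x"
  unfolding poly_eval_def
  by (rule setsum_keys_plus_distrib) (simp_all add: distrib_right)

lemma poly_eval_Var: "poly_eval (Var i) x = x $ i"
proof -
  have "(\<Prod>j\<in>UNIV. (x $ j) ^ Poly_Mapping.lookup (Poly_Mapping.single i 1) j)
      = (\<Prod>j\<in>UNIV. if i = j then x $ j else 1)"
    by (rule prod.cong) (auto simp: lookup_single when_def)
  also have "\<dots> = x $ i"
    by simp
  finally show ?thesis
    by (simp add: poly_eval_def Var_def)
qed

lemma poly_eval_cong_vars:
  assumes "\<And>j. j \<in> vars p \<Longrightarrow> x $ j = y $ j"
  shows "poly_eval p x = poly_eval p y"
  unfolding poly_eval_def
proof (intro sum.cong prod.cong refl arg_cong2[where f = "(*)"])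
  fix m j assume "m \<in> Poly_Mapping.keys p"
  then show "(x $ j) ^ Poly_Mapping.lookup m j = (y $ j) ^ Poly_Mapping.lookup m j"
    using assms[of j]
    \<comment> \<open>If \<open>j\<close> does not occur in \<open>m\<close>, the exponent is 0 and
      both powers are 1, even where \<open>x\<close> and \<open>y\<close> differ.\<close>
    by (cases "j \<in> Poly_Mapping.keys m") (fastforce simp: vars_def, simp add: not_in_keys_iff_lookup_eq_zero)
qed

text \<open>Independence of the \<open>i\<close>-th coordinate is expressed below as invariance
  under \<open>update_coord i t\<close> for all \<open>t\<close>.\<close>

definition update_coord :: "'n::finite \<Rightarrow> 'a \<Rightarrow> 'a ^ 'n \<Rightarrow> 'a ^ 'n" where
  "update_coord i t x = (\<chi> j. if j = i then t else x $ j)"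

lemma update_coord_nth [simp]: "update_coord i t x $ j = (if j = i then t else x $ j)"
  by (simp add: update_coord_def)

lemma update_coord_update_coord [simp]:
  "update_coord i s (update_coord i t x) = update_coord i s x"
  by (simp add: vec_eq_iff)

lemma update_coord_self [simp]: "update_coord i (x $ i) x = x"
  by (simp add: vec_eq_iff)

definition shear :: "'n::finite \<Rightarrow> ('a::ab_group_add ^ 'n \<Rightarrow> 'a) \<Rightarrow> 'a ^ 'n \<Rightarrow> 'a ^ 'n" where
  "shear i f x = update_coord i (x $ i + f x) x"

definition scale_coord :: "'n::finite \<Rightarrow> 'a::times \<Rightarrow> 'a ^ 'n \<Rightarrow> 'a ^ 'n" where
  "scale_coord i c x = update_coord i (c * x $ i) x"

lemma induced_map_elementary: "induced_map (elementary i a) = shear i (poly_eval a)"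
  by (rule ext)
     (simp add: vec_eq_iff induced_map_def elementary_def shear_def poly_eval_plus poly_eval_Var)

text \<open>Since \<open>f\<close> ignores the coordinate being changed, it takes the same value
  before and after the shear, so the shear by \<open>- f\<close> is a two-sided inverse.\<close>

lemma shear_permutes:
  assumes "\<And>t x. f (update_coord i t x) = f x"
  shows "shear i f permutes UNIV"
proof (rule bij_imp_permutes)
  show "bij (shear i f)"
    by (rule o_bij[where g = "shear i (\<lambda>x. - f x)"]) (auto simp: shear_def assms fun_eq_iff)
qed simp

lemma scale_coord_permutes:
  fixes c :: "'a::field"
  assumes "c \<noteq> 0"
  shows "scale_coord i c permutes UNIV"
proof (rule bij_imp_permutes)
  show "bij (scale_coord i c)"
    by (rule o_bij[where g = "scale_coord i (inverse c)"])
       (auto simp: scale_coord_def assms fun_eq_iff mult.assoc[symmetric])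
qed simp

lemma evenperm_shear:
  fixes f :: "'a::{field,finite} ^ 'n::finite \<Rightarrow> 'a" and c :: 'a
  assumes f: "\<And>t x. f (update_coord i t x) = f x"
    and c: "c \<noteq> 0" "c \<noteq> 1"
  shows "evenperm (shear i f)"
proof -
  define g where "g x = f x / (c - 1)" for x :: "'a ^ 'n"
  have g: "g (update_coord i t x) = g x" for t x
    by (simp add: g_def f)
  have fg: "f x = (c - 1) * g x" for x
    using c by (simp add: g_def)
  have perm: "permutation (shear i f)" "permutation (shear i g)" "permutation (scale_coord i c)"
    using shear_permutes[OF f] shear_permutes[OF g] scale_coord_permutes[OF c(1)]
    by (auto intro: permutes_imp_permutation[OF finite])
  \<comment> \<open>The commutator identity cleared of inverses: both sides send the
    \<open>i\<close>-th coordinate to \<open>c * x $ i + c * g x\<close>, because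
    \<open>f x + g x = c * g x\<close>.\<close>
  have "shear i f \<circ> (shear i g \<circ> scale_coord i c) = scale_coord i c \<circ> shear i g"
    by (rule ext) (simp add: shear_def scale_coord_def f g, simp add: fg algebra_simps)
  then have "evenperm (shear i f \<circ> (shear i g \<circ> scale_coord i c))
      = evenperm (scale_coord i c \<circ> shear i g)"
    by simp
  \<comment> \<open>The parities of \<open>shear i g\<close> and of the scaling occur on both sides
    and cancel, whatever they are.\<close>
  then show ?thesis
    by (auto simp: evenperm_comp permutation_compose perm)
qed

lemma ex_neq_0_1:
  assumes "CARD('a::{zero_neq_one,finite}) > 2"
  shows "\<exists>c::'a. c \<noteq> 0 \<and> c \<noteq> 1"
proof (rule ccontr)
  assume "\<nexists>c::'a. c \<noteq> 0 \<and> c \<noteq> 1"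
  then have "(UNIV :: 'a set) = {0, 1}"
    by auto
  then have "CARD('a) = card {0, 1 :: 'a}"
    by (rule arg_cong)
  with assms show False
    by simp
qed

theorem corollary1:
  assumes "odd CARD('a::{field,finite}) \<or> (\<exists>m::nat. m \<ge> 2 \<and> CARD('a) = 2 ^ m)"
  shows "induced_map ` (EA :: (('a, 'n::finite) mpoly ^ 'n) set) \<subseteq> Alt (UNIV :: ('a ^ 'n) set)"
proof -
  \<comment> \<open>2 is not odd, and \<open>2 ^ m\<close> is at least 4 for
    \<open>m \<ge> 2\<close>.\<close>
  have "CARD('a) \<noteq> 2"
    using assms power_increasing[of 2 _ "2::nat"] by fastforce
  moreover have "card {0, 1 :: 'a} \<le> CARD('a)"
    by (rule card_mono) auto
  ultimately obtain c :: 'a where c: "c \<noteq> 0" "c \<noteq> 1"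
    using ex_neq_0_1[where 'a = 'a] by auto
  show ?thesis
  proof
    fix F assume "F \<in> induced_map ` (EA :: (('a, 'n) mpoly ^ 'n) set)"
    then obtain i and a :: "('a, 'n) mpoly"
      where a: "i \<notin> vars a" and F: "F = shear i (poly_eval a)"
      by (auto simp: EA_def induced_map_elementary)
    have "poly_eval a (update_coord i t x) = poly_eval a x" for t x
      using a by (intro poly_eval_cong_vars) auto
    then show "F \<in> Alt UNIV"
      unfolding Alt_def F using shear_permutes evenperm_shear c by blast
  qed
qed

end
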